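(* Let $\alpha$ be a stable non-negative increasing sequence tending to infinity, let $K(b_{n,k})$ be a Köthe space, and let $\theta=(\theta_n)_{n\in\mathbb{N}_0}\in(\Lambda_\infty(\alpha))'$. Assume that for every $m\in\mathbb{N}$ the sequence $(e^{m\alpha_n})_{n\in\mathbb{N}}$ belongs to $K(b_{n,k})$. Then the Hankel operator $H_\theta:\Lambda_\infty(\alpha)\to K(b_{n,k})$ is well-defined and continuous. If, moreover, $K(b_{n,k})$ is Montel, then $H_\theta$ is also compact.
   Context: $\mathbb{N}=\{1,2,\dots\}$, $\mathbb{N}_0=\mathbb{N}\cup\{0\}$. A Köthe matrix is a matrix $(b_{n,k})_{n,k\in\mathbb{N}}$ of non-negative numbers such that for each $n$ there is $k$ with $b_{n,k}>0$, and $b_{n,k}\le b_{n,k+1}$ for all $n,k$. The associated Köthe space is the Fréchet space $K(b_{n,k})=\{x=(x_n)_{n\in\mathbb{N}}:\ \|x\|_k:=\sum_{n=1}^\infty|x_n|b_{n,k}<\infty\ \text{for all }k\in\mathbb{N}\}$ with seminorms $\|\cdot\|_k$, $k\in\mathbb{N}$. For a non-negative increasing sequence $\alpha=(\alpha_n)_{n\in\mathbb{N}}$ with $\alpha_n\to\infty$, the power series space of infinite type is $\Lambda_\infty(\alpha)=K(e^{k\alpha_n})$, i.e. $\|x\|_k=\sum_{n=1}^\infty|x_n|e^{k\alpha_n}$. Its dual is identified with the sequence space $(\Lambda_\infty(\alpha))'=\{y=(y_n)_{n\in\mathbb{N}}:\ \sup_n|y_n|e^{-k\alpha_n}<\infty\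 \text{for some }k\in\mathbb{N}\}$. The sequence $\alpha$ is stable if $\sup_{n\in\mathbb{N}}\alpha_{2n}/\alpha_n<\infty$, i.e. there is $M$ with $\alpha_{2n}\le M\alpha_n$ for all $n$. A Fréchet space is Montel if each of its bounded sets is relatively compact. The sequence $e_n$ has $1$ in the $n$-th place and $0$ elsewhere. A sequence $\theta=(\theta_n)_{n\in\mathbb{N}_0}$ is identified with the sequence $(\theta_{n-1})_{n\in\mathbb{N}}=(\theta_0,\theta_1,\theta_2,\dots)$ when it is said to belong to a sequence space. The Hankel operator $H_\theta$ from a Köthe space $E$ to a Köthe space $F$ is given by $H_\theta e_n=(\theta_{n-1},\theta_n,\theta_{n+1},\dots)=\sum_{j=1}^\infty\theta_{j+n-2}e_j$ for $n\in\mathbb{N}$ and $H_\theta x=\sum_{n=1}^\infty x_nH_\theta e_n$ for $x=(x_n)\in E$. It is well-defined if $H_\theta e_n\in F$ for all $n$ and the series $\sum_n x_nH_\theta e_n$ converges in $F$ for every $x\in E$. A linear map $T:E\to F$ between Fréchet spaces is compact if $T(U)$ is precompact in $F$ for some neighborhood $U$ of zero in $E$. *)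

theory Defs
  imports "HOL-Analysis.Analysis"
begin

text \<open>
  Index conventions. A sequence \<open>(x\<^sub>n)\<close> indexed by \<open>n = 1, 2, \<dots>\<close> is encoded as the function
  \<open>x :: nat \<Rightarrow> _\<close> with \<open>x i\<close> standing for \<open>x\<^sub>i\<^sub>+\<^sub>1\<close>; likewise \<open>b i k\<close> stands for \<open>b\<^sub>i\<^sub>+\<^sub>1\<^sub>,\<^sub>k\<^sub>+\<^sub>1\<close>.
  A sequence \<open>\<theta>\<close> indexed from \<open>0\<close> is the function \<open>\<theta>\<close> itself, so that its identification with the
  \<open>1\<close>-indexed sequence \<open>(\<theta>\<^sub>n\<^sub>-\<^sub>1)\<close> is the identity in this encoding.

  The scalars form a complete real normed field with multiplicative norm, which by the
  Gelfand-Mazur theorem means the real or the complex numbers.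
\<close>

definition kothe_matrix :: "(nat \<Rightarrow> nat \<Rightarrow> real) \<Rightarrow> bool" where
  "kothe_matrix b \<longleftrightarrow>
     (\<forall>n k. 0 \<le> b n k) \<and> (\<forall>n. \<exists>k. 0 < b n k) \<and> (\<forall>n k. b n k \<le> b n (Suc k))"

definition kothe_space ::
    "(nat \<Rightarrow> nat \<Rightarrow> real) \<Rightarrow> (nat \<Rightarrow> 'a::{real_normed_field,banach}) set" where
  "kothe_space b = {x. \<forall>k. summable (\<lambda>n. norm (x n) * b n k)}"

definition kothe_seminorm ::
    "(nat \<Rightarrow> nat \<Rightarrow> real) \<Rightarrow> nat \<Rightarrow> (nat \<Rightarrow> 'a::{real_normed_field,banach}) \<Rightarrow> real" where
  "kothe_seminorm b k x = (\<Sum>n. norm (x n) * b n k)"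

definition kothe_topology ::
    "(nat \<Rightarrow> nat \<Rightarrow> real) \<Rightarrow> (nat \<Rightarrow> 'a::{real_normed_field,banach}) topology" where
  "kothe_topology b = topology_generated_by
     {{y \<in> kothe_space b. kothe_seminorm b k (\<lambda>i. y i - x i) < \<epsilon>} | x k \<epsilon>.
        x \<in> kothe_space b \<and> 0 < \<epsilon>}"

lemma topspace_kothe_topology [simp]:
  "topspace (kothe_topology b :: (nat \<Rightarrow> 'a::{real_normed_field,banach}) topology) = kothe_space b"
proof (rule equalityI)
  show "topspace (kothe_topology b) \<subseteq> kothe_space b"
    unfolding kothe_topology_def topology_generated_by_topspace by blast
  show "kothe_space b \<subseteq> topspace (kothe_topology b :: (nat \<Rightarrow> 'a) topology)"
  proof
    fix x :: "nat \<Rightarrow> 'a" assume x: "x \<in> kothe_space b"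
    let ?B = "{y \<in> kothe_space b. kothe_seminorm b 0 (\<lambda>i. y i - x i) < 1}"
    have "x \<in> ?B"
      using x by (simp add: kothe_seminorm_def)
    moreover have "openin (kothe_topology b) ?B"
      unfolding kothe_topology_def
      by (rule topology_generated_by_Basis) (use x zero_less_one in blast)
    ultimately show "x \<in> topspace (kothe_topology b)"
      using openin_subset by blast
  qed
qed

definition power_series_matrix :: "(nat \<Rightarrow> real) \<Rightarrow> nat \<Rightarrow> nat \<Rightarrow> real" where
  "power_series_matrix \<alpha> n k = exp (real (Suc k) * \<alpha> n)"

text \<open>The power series space of infinite type \<open>\<Lambda>\<^sub>\<infinity>(\<alpha>)\<close>, as a topological space.\<close>

abbreviation power_series_topology ::
    "(nat \<Rightarrow> real) \<Rightarrow> (nat \<Rightarrow> 'a::{real_normed_field,banach}) topology" where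
  "power_series_topology \<alpha> \<equiv> kothe_topology (power_series_matrix \<alpha>)"

definition power_series_dual ::
    "(nat \<Rightarrow> real) \<Rightarrow> (nat \<Rightarrow> 'a::{real_normed_field,banach}) set" where
  "power_series_dual \<alpha> =
     {y. \<exists>k\<ge>1. bdd_above (range (\<lambda>n. norm (y n) * exp (- real (k::nat) * \<alpha> n)))}"

text \<open>In \<open>1\<close>-based indexing this reads \<open>\<alpha>\<^sub>2\<^sub>n \<le> M \<alpha>\<^sub>n\<close> for all \<open>n \<ge> 1\<close>.\<close>

definition stable_sequence :: "(nat \<Rightarrow> real) \<Rightarrow> bool" where
  "stable_sequence \<alpha> \<longleftrightarrow> (\<exists>M. \<forall>n\<ge>1. \<alpha> (2 * n - 1) \<le> M * \<alpha> (n - 1))"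

text \<open>
  The following notions refer to a topology on a space of sequences that carries the
  pointwise vector space operations.
\<close>

definition zero_nbhd :: "(nat \<Rightarrow> 'a::{real_normed_field,banach}) topology \<Rightarrow> (nat \<Rightarrow> 'a) set \<Rightarrow> bool" where
  "zero_nbhd X U \<longleftrightarrow> U \<subseteq> topspace X \<and> (\<exists>V. openin X V \<and> (\<lambda>_. 0) \<in> V \<and> V \<subseteq> U)"

definition bounded_in :: "(nat \<Rightarrow> 'a::{real_normed_field,banach}) topology \<Rightarrow> (nat \<Rightarrow> 'a) set \<Rightarrow> bool" where
  "bounded_in X S \<longleftrightarrow> S \<subseteq> topspace X \<and>
     (\<forall>U. zero_nbhd X U \<longrightarrow> (\<exists>t>0. S \<subseteq> (\<lambda>x i. of_real t * x i) ` U))"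

definition relatively_compact_in :: "'b topology \<Rightarrow> 'b set \<Rightarrow> bool" where
  "relatively_compact_in X S \<longleftrightarrow> S \<subseteq> topspace X \<and> compactin X (X closure_of S)"

definition montel :: "(nat \<Rightarrow> 'a::{real_normed_field,banach}) topology \<Rightarrow> bool" where
  "montel X \<longleftrightarrow> (\<forall>S. bounded_in X S \<longrightarrow> relatively_compact_in X S)"

definition precompact_in :: "(nat \<Rightarrow> 'a::{real_normed_field,banach}) topology \<Rightarrow> (nat \<Rightarrow> 'a) set \<Rightarrow> bool" where
  "precompact_in X S \<longleftrightarrow> S \<subseteq> topspace X \<and>
     (\<forall>U. zero_nbhd X U \<longrightarrow>
        (\<exists>A. finite A \<and> A \<subseteq> topspace X \<and> S \<subseteq> (\<Union>a\<in>A. (\<lambda>x i. a i + x i) ` U)))"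

definition linear_between ::
    "(nat \<Rightarrow> 'a::{real_normed_field,banach}) topology \<Rightarrow> (nat \<Rightarrow> 'a) topology \<Rightarrow>
     ((nat \<Rightarrow> 'a) \<Rightarrow> (nat \<Rightarrow> 'a)) \<Rightarrow> bool" where
  "linear_between X Y T \<longleftrightarrow> T \<in> topspace X \<rightarrow> topspace Y \<and>
     (\<forall>x\<in>topspace X. \<forall>y\<in>topspace X. T (\<lambda>i. x i + y i) = (\<lambda>i. T x i + T y i)) \<and>
     (\<forall>c. \<forall>x\<in>topspace X. T (\<lambda>i. c * x i) = (\<lambda>i. c * T x i))"

definition compact_operator ::
    "(nat \<Rightarrow> 'a::{real_normed_field,banach}) topology \<Rightarrow> (nat \<Rightarrow> 'a) topology \<Rightarrow>
     ((nat \<Rightarrow> 'a) \<Rightarrow> (nat \<Rightarrow> 'a)) \<Rightarrow> bool" where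
  "compact_operator X Y T \<longleftrightarrow> linear_between X Y T \<and>
     (\<exists>U. zero_nbhd X U \<and> precompact_in Y (T ` U))"

text \<open>
  \<open>hankel_column \<theta> n\<close> is the image of the \<open>n\<close>-th unit vector (counted from \<open>0\<close>). The Hankel
  operator depends on its codomain \<open>Y\<close> because the series defining it is summed in \<open>Y\<close>;
  for a Koethe space over a \<open>kothe_matrix\<close> the limit is unique.
\<close>

definition hankel_column :: "(nat \<Rightarrow> 'a) \<Rightarrow> nat \<Rightarrow> nat \<Rightarrow> 'a" where
  "hankel_column \<theta> n = (\<lambda>j. \<theta> (j + n))"

definition hankel_partial_sum ::
    "(nat \<Rightarrow> 'a::{real_normed_field,banach}) \<Rightarrow> (nat \<Rightarrow> 'a) \<Rightarrow> nat \<Rightarrow> nat \<Rightarrow> 'a" where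
  "hankel_partial_sum \<theta> x N = (\<lambda>j. \<Sum>n<N. x n * hankel_column \<theta> n j)"

definition hankel_well_defined ::
    "(nat \<Rightarrow> 'a::{real_normed_field,banach}) topology \<Rightarrow> (nat \<Rightarrow> 'a) topology \<Rightarrow> (nat \<Rightarrow> 'a) \<Rightarrow> bool" where
  "hankel_well_defined X Y \<theta> \<longleftrightarrow>
     (\<forall>n. hankel_column \<theta> n \<in> topspace Y) \<and>
     (\<forall>x\<in>topspace X. \<exists>y. limitin Y (hankel_partial_sum \<theta> x) y sequentially)"

definition hankel_operator ::
    "(nat \<Rightarrow> 'a::{real_normed_field,banach}) topology \<Rightarrow> (nat \<Rightarrow> 'a) \<Rightarrow> (nat \<Rightarrow> 'a) \<Rightarrow> (nat \<Rightarrow> 'a)" where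
  "hankel_operator Y \<theta> x = (THE y. limitin Y (hankel_partial_sum \<theta> x) y sequentially)"

end

theory Submission imports Defs begin

text \<open>
  If \<open>\<parallel>\<theta>\<^sub>n\<parallel> \<le> C exp (p \<alpha>\<^sub>n)\<close>, then stability of \<open>\<alpha>\<close> decouples the indices:
  \<open>\<alpha>\<^sub>j\<^sub>+\<^sub>n \<le> M (\<alpha>\<^sub>j + \<alpha>\<^sub>n)\<close>, hence \<open>\<parallel>\<theta>\<^sub>j\<^sub>+\<^sub>n\<parallel> \<le> C w\<^sub>j w\<^sub>n\<close> with \<open>w = exp (q \<alpha>)\<close>, \<open>q \<ge> p M\<close>.
  Summing over both indices gives \<open>\<parallel>H\<^sub>\<theta> x\<parallel>\<^sub>k \<le> C \<parallel>w\<parallel>\<^sub>k \<parallel>x\<parallel>\<^sub>q\<close> for every \<open>k\<close>, where \<open>q\<close> does not depend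
  on \<open>k\<close>. So one neighbourhood of zero, the unit ball of \<open>\<parallel>\<cdot>\<parallel>\<^sub>q\<close>, is mapped to a bounded set,
  and in a Montel space bounded sets are relatively compact, hence precompact.
\<close>

section \<open>The topology of a Koethe space\<close>

lemma kothe_matrix_nonneg: "kothe_matrix b \<Longrightarrow> 0 \<le> b n k"
  by (simp add: kothe_matrix_def)

lemma kothe_matrix_mono: "kothe_matrix b \<Longrightarrow> k \<le> l \<Longrightarrow> b n k \<le> b n l"
  unfolding kothe_matrix_def by (blast intro: lift_Suc_mono_le)

text \<open>The comparison test, in the form used for all later membership claims and estimates: a
  pointwise majorant fixes both at once. The hypothesis bounds a norm by \<open>c * v n\<close>, so
  the signs of \<open>c\<close> and \<open>v\<close> need not be known separately.\<close>

lemma kothe_space_dominated: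
  assumes "\<And>k. summable (\<lambda>n. v n * b n k)"
    and "\<And>n. norm (x n) \<le> c * v n" and "kothe_matrix b"
  shows "x \<in> kothe_space b"
    and "kothe_seminorm b k x \<le> c * (\<Sum>n. v n * b n k)"
proof -
  have le: "norm (x n) * b n k \<le> c * (v n * b n k)" for n k
    using mult_right_mono[OF assms(2) kothe_matrix_nonneg[OF assms(3)]] by (simp add: mult.assoc)
  have sm: "summable (\<lambda>n. norm (x n) * b n k)" for k
    by (rule summable_comparison_test'[OF summable_mult[OF assms(1)]])
      (use le kothe_matrix_nonneg[OF assms(3)] in \<open>simp add: abs_mult\<close>)
  then show "x \<in> kothe_space b"
    by (simp add: kothe_space_def)
  have "(\<Sum>n. norm (x n) * b n k) \<le> (\<Sum>n. c * (v n * b n k))"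
    by (rule suminf_le[OF le sm summable_mult[OF assms(1)]])
  then show "kothe_seminorm b k x \<le> c * (\<Sum>n. v n * b n k)"
    by (simp add: kothe_seminorm_def suminf_mult[OF assms(1)])
qed

lemma kothe_space_add:
  assumes "kothe_matrix b" "x \<in> kothe_space b" "y \<in> kothe_space b"
  shows "(\<lambda>i. x i + y i) \<in> kothe_space b"
    and "kothe_seminorm b k (\<lambda>i. x i + y i) \<le> kothe_seminorm b k x + kothe_seminorm b k y"
proof -
  let ?v = "\<lambda>n. norm (x n) + norm (y n)"
  have sx: "summable (\<lambda>n. norm (x n) * b n k)" and sy: "summable (\<lambda>n. norm (y n) * b n k)" for k
    using assms by (auto simp: kothe_space_def)
  have s: "summable (\<lambda>n. ?v n * b n k)" for k
    using summable_add[OF sx sy] by (simp add: distrib_right)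
  have le: "norm (x n + y n) \<le> 1 * ?v n" for n
    by (simp add: norm_triangle_ineq)
  show "(\<lambda>i. x i + y i) \<in> kothe_space b"
    by (rule kothe_space_dominated(1)[OF s le assms(1)])
  show "kothe_seminorm b k (\<lambda>i. x i + y i) \<le> kothe_seminorm b k x + kothe_seminorm b k y"
    using kothe_space_dominated(2)[where x = "\<lambda>i. x i + y i", OF s le assms(1), of k]
      suminf_add[OF sx sy, of k k]
    by (simp add: kothe_seminorm_def distrib_right)
qed

lemma kothe_space_scale:
  assumes "x \<in> kothe_space b"
  shows "(\<lambda>i. c * x i) \<in> kothe_space b"
    and "kothe_seminorm b k (\<lambda>i. c * x i) = norm c * kothe_seminorm b k x"
  using assms
  by (simp_all add: kothe_space_def kothe_seminorm_def norm_mult mult.assoc summable_mult suminf_mult)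

lemma kothe_space_diff:
  assumes "kothe_matrix b" "x \<in> kothe_space b" "y \<in> kothe_space b"
  shows "(\<lambda>i. x i - y i) \<in> kothe_space b"
  using kothe_space_add(1)[OF assms(1,2) kothe_space_scale(1)[OF assms(3), of "-1"]] by simp

lemma kothe_space_zero: "(\<lambda>_. 0) \<in> kothe_space b"
  by (simp add: kothe_space_def)

lemma kothe_seminorm_nonneg:
  assumes "kothe_matrix b" "x \<in> kothe_space b"
  shows "0 \<le> kothe_seminorm b k x"
  unfolding kothe_seminorm_def
  by (rule suminf_nonneg) (use assms in \<open>auto simp: kothe_space_def kothe_matrix_nonneg\<close>)

lemma kothe_seminorm_mono:
  assumes "kothe_matrix b" "x \<in> kothe_space b" "k \<le> l"
  shows "kothe_seminorm b k x \<le> kothe_seminorm b l x"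
  unfolding kothe_seminorm_def
  by (rule suminf_le) (use assms in \<open>auto simp: kothe_space_def intro: mult_left_mono kothe_matrix_mono\<close>)

lemma kothe_seminorm_triangle:
  assumes "kothe_matrix b" "x \<in> kothe_space b" "y \<in> kothe_space b" "z \<in> kothe_space b"
  shows "kothe_seminorm b k (\<lambda>i. x i - z i)
    \<le> kothe_seminorm b k (\<lambda>i. x i - y i) + kothe_seminorm b k (\<lambda>i. y i - z i)"
  using kothe_space_add(2)[OF assms(1) kothe_space_diff[OF assms(1,2,3)]
      kothe_space_diff[OF assms(1,3,4)], of k]
  by simp

lemma kothe_seminorm_minus_commute:
  "kothe_seminorm b k (\<lambda>i. x i - y i) = kothe_seminorm b k (\<lambda>i. y i - x i)"
  by (simp add: kothe_seminorm_def norm_minus_commute)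

section \<open>Balls as a basis of the topology\<close>

definition kothe_ball ::
    "(nat \<Rightarrow> nat \<Rightarrow> real) \<Rightarrow> nat \<Rightarrow> (nat \<Rightarrow> 'a::{real_normed_field,banach}) \<Rightarrow> real \<Rightarrow> (nat \<Rightarrow> 'a) set"
  where "kothe_ball b k x \<epsilon> = {y \<in> kothe_space b. kothe_seminorm b k (\<lambda>i. y i - x i) < \<epsilon>}"

lemma kothe_ball_subset: "kothe_ball b k x \<epsilon> \<subseteq> kothe_space b"
  by (auto simp: kothe_ball_def)

lemma centre_in_kothe_ball: "x \<in> kothe_space b \<Longrightarrow> 0 < \<epsilon> \<Longrightarrow> x \<in> kothe_ball b k x \<epsilon>"
  by (simp add: kothe_ball_def kothe_seminorm_def)

lemma openin_kothe_ball:
  "x \<in> kothe_space b \<Longrightarrow> 0 < \<epsilon> \<Longrightarrow> openin (kothe_topology b) (kothe_ball b k x \<epsilon>)"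
  unfolding kothe_topology_def kothe_ball_def
  by (rule topology_generated_by_Basis) blast

text \<open>By definition the balls only form a subbasis. Induction on the generation of an open set
  shows that they form a basis, and that the ball can even be centred at the given point.\<close>

lemma openin_kothe_topologyD:
  assumes b: "kothe_matrix b" and "openin (kothe_topology b) U" and "x \<in> U"
  obtains k \<epsilon> where "0 < \<epsilon>" "kothe_ball b k x \<epsilon> \<subseteq> U"
proof -
  let ?S = "{{y \<in> kothe_space b. kothe_seminorm b k (\<lambda>i. y i - x i) < \<epsilon>} | x k \<epsilon>.
        x \<in> kothe_space b \<and> 0 < \<epsilon>}"
  have "generate_topology_on ?S U"
    using assms(2) by (simp add: kothe_topology_def openin_topology_generated_by_iff)
  then have "\<forall>x\<in>U. \<exists>k \<epsilon>. 0 < \<epsilon> \<and> kothe_ball b k x \<epsilon> \<subseteq> U"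
  proof induction
    case Empty
    then show ?case by simp
  next
    case (Int U V)
    show ?case
    proof
      fix x assume "x \<in> U \<inter> V"
      then obtain k \<epsilon> l \<delta> where kl: "0 < \<epsilon>" "kothe_ball b k x \<epsilon> \<subseteq> U" "0 < \<delta>" "kothe_ball b l x \<delta> \<subseteq> V"
        using Int.IH by blast
      \<comment> \<open>Openness of \<open>U\<close> places \<open>x\<close> in the Koethe space, so
        that the seminorms of \<open>y - x\<close> are convergent sums and can be compared.\<close>
      have "openin (kothe_topology b) U"
        unfolding kothe_topology_def openin_topology_generated_by_iff by (rule Int.hyps(1))
      then have x: "x \<in> kothe_space b"
        using \<open>x \<in> U \<inter> V\<close> openin_subset by fastforce
      \<comment> \<open>Seminorms increase with their index, so the larger index and the smaller
        radius give a ball inside both given ones.\<close>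
      have "kothe_ball b (max k l) x (min \<epsilon> \<delta>) \<subseteq> kothe_ball b i x \<eta>"
        if "i \<le> max k l" "min \<epsilon> \<delta> \<le> \<eta>" for i \<eta>
      proof
        fix y assume y: "y \<in> kothe_ball b (max k l) x (min \<epsilon> \<delta>)"
        then have "kothe_seminorm b i (\<lambda>i. y i - x i) \<le> kothe_seminorm b (max k l) (\<lambda>i. y i - x i)"
          using that(1) x by (intro kothe_seminorm_mono kothe_space_diff b) (auto simp: kothe_ball_def)
        then show "y \<in> kothe_ball b i x \<eta>"
          using y that(2) by (auto simp: kothe_ball_def)
      qed
      then have "kothe_ball b (max k l) x (min \<epsilon> \<delta>) \<subseteq> U \<inter> V"
        using kl by (meson Int_greatest max.cobounded1 max.cobounded2 min.cobounded1 min.cobounded2 subset_trans)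
      then show "\<exists>k \<epsilon>. 0 < \<epsilon> \<and> kothe_ball b k x \<epsilon> \<subseteq> U \<inter> V"
        using kl by (intro exI[of _ "max k l"] exI[of _ "min \<epsilon> \<delta>"]) simp
    qed
  next
    case (UN K)
    then show ?case by (meson UnionE Union_upper order_trans)
  next
    case (Basis V)
    then obtain z k \<epsilon> where V: "V = kothe_ball b k z \<epsilon>" and z: "z \<in> kothe_space b"
      unfolding kothe_ball_def by blast
    show ?case
    proof
      fix x assume x: "x \<in> V"
      \<comment> \<open>Recentring: this is the radius left over at \<open>x\<close>, and the
        triangle inequality keeps the new ball inside the old one.\<close>
      let ?\<delta> = "\<epsilon> - kothe_seminorm b k (\<lambda>i. x i - z i)"
      have "kothe_ball b k x ?\<delta> \<subseteq> V"
      proof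
        fix y assume y: "y \<in> kothe_ball b k x ?\<delta>"
        then show "y \<in> V"
          using kothe_seminorm_triangle[OF b, of y x z k] x z unfolding V kothe_ball_def by simp
      qed
      moreover have "0 < ?\<delta>"
        using x by (simp add: V kothe_ball_def)
      ultimately show "\<exists>k \<epsilon>. 0 < \<epsilon> \<and> kothe_ball b k x \<epsilon> \<subseteq> V" by blast
    qed
  qed
  then show thesis
    using assms(3) that by blast
qed

lemma zero_nbhd_kothe_ball: "0 < \<epsilon> \<Longrightarrow> zero_nbhd (kothe_topology b) (kothe_ball b k (\<lambda>_. 0) \<epsilon>)"
  unfolding zero_nbhd_def topspace_kothe_topology
  by (intro conjI exI[of _ "kothe_ball b k (\<lambda>_. 0) \<epsilon>"] openin_kothe_ball centre_in_kothe_ball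
      kothe_space_zero kothe_ball_subset order_refl)

lemma zero_nbhd_kotheD:
  assumes "kothe_matrix b" "zero_nbhd (kothe_topology b) U"
  obtains k \<epsilon> where "0 < \<epsilon>" "kothe_ball b k (\<lambda>_. 0) \<epsilon> \<subseteq> U"
  using assms openin_kothe_topologyD[OF assms(1)] unfolding zero_nbhd_def by (metis subset_trans)

section \<open>Convergence and separation\<close>

lemma limitin_kotheI:
  assumes "kothe_matrix b" "y \<in> kothe_space b" "\<And>n. f n \<in> kothe_space b"
    and "\<And>k. (\<lambda>n. kothe_seminorm b k (\<lambda>i. f n i - y i)) \<longlonglongrightarrow> 0"
  shows "limitin (kothe_topology b) f y sequentially"
  unfolding limitin_def
proof (intro conjI allI impI)
  fix U assume "openin (kothe_topology b) U \<and> y \<in> U"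
  then obtain k \<epsilon> where "0 < \<epsilon>" "kothe_ball b k y \<epsilon> \<subseteq> U"
    using openin_kothe_topologyD[OF assms(1)] by metis
  then show "\<forall>\<^sub>F n in sequentially. f n \<in> U"
    using order_tendstoD(2)[OF assms(4) \<open>0 < \<epsilon>\<close>, of k] assms(3)
    by (auto simp: kothe_ball_def elim!: eventually_mono)
qed (use assms in simp)

text \<open>Each coordinate has a positive weight in some seminorm, and a convergent sum of
  non-negative terms vanishes only if all its terms do.\<close>

lemma kothe_seminorm_zero_imp_eq:
  assumes b: "kothe_matrix b" and xy: "x \<in> kothe_space b" "y \<in> kothe_space b"
    and "\<And>k. kothe_seminorm b k (\<lambda>i. x i - y i) = 0"
  shows "x = y"
proof
  fix i
  obtain k where "0 < b i k"
    using b unfolding kothe_matrix_def by blast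
  moreover have "summable (\<lambda>n. norm (x n - y n) * b n k)"
    using kothe_space_diff[OF b xy] by (simp add: kothe_space_def)
  then have "norm (x i - y i) * b i k = 0"
    using assms(4)[of k] suminf_eq_zero_iff[of "\<lambda>n. norm (x n - y n) * b n k"]
    by (simp add: kothe_seminorm_def kothe_matrix_nonneg[OF b])
  ultimately show "x i = y i" by simp
qed

text \<open>Needed for uniqueness of limits, which makes the description by \<open>THE\<close> in
  \<open>hankel_operator\<close> meaningful. Balls of half the distance in a separating seminorm are
  disjoint.\<close>

lemma Hausdorff_kothe_topology:
  assumes b: "kothe_matrix b"
  shows "Hausdorff_space (kothe_topology b :: (nat \<Rightarrow> 'a::{real_normed_field,banach}) topology)"
  unfolding Hausdorff_space_def
proof (intro allI impI)
  fix x y :: "nat \<Rightarrow> 'a"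
  assume "x \<in> topspace (kothe_topology b) \<and> y \<in> topspace (kothe_topology b) \<and> x \<noteq> y"
  then have xy: "x \<in> kothe_space b" "y \<in> kothe_space b" "x \<noteq> y" by auto
  then obtain k where "kothe_seminorm b k (\<lambda>i. x i - y i) \<noteq> 0"
    using kothe_seminorm_zero_imp_eq[OF b] by blast
  moreover define \<epsilon> where "\<epsilon> = kothe_seminorm b k (\<lambda>i. x i - y i) / 2"
  ultimately have \<epsilon>: "0 < \<epsilon>"
    using kothe_seminorm_nonneg[OF b kothe_space_diff[OF b xy(1,2)], of k] by simp
  have "disjnt (kothe_ball b k x \<epsilon>) (kothe_ball b k y \<epsilon>)"
    unfolding disjnt_iff
  proof (intro allI notI)
    fix z assume z: "z \<in> kothe_ball b k x \<epsilon> \<and> z \<in> kothe_ball b k y \<epsilon>"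
    then show False
      using kothe_seminorm_triangle[OF b xy(1) _ xy(2), of z k] kothe_seminorm_minus_commute[of b k x z]
      by (auto simp: kothe_ball_def \<epsilon>_def)
  qed
  with openin_kothe_ball[OF xy(1) \<epsilon>] openin_kothe_ball[OF xy(2) \<epsilon>]
    centre_in_kothe_ball[OF xy(1) \<epsilon>] centre_in_kothe_ball[OF xy(2) \<epsilon>]
  show "\<exists>U V. openin (kothe_topology b) U \<and> openin (kothe_topology b) V \<and> x \<in> U \<and> y \<in> V \<and> disjnt U V"
    by metis
qed

section \<open>Continuity of linear maps\<close>

lemma linear_between_kothe_diff:
  assumes "linear_between (kothe_topology a) Y T" "x \<in> kothe_space a" "y \<in> kothe_space a"
  shows "T (\<lambda>i. x i - y i) = (\<lambda>i. T x i - T y i)"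
proof -
  define z where "z = (\<lambda>i. (-1) * y i)"
  have z: "z \<in> kothe_space a"
    unfolding z_def by (rule kothe_space_scale(1)[OF assms(3)])
  have "T (\<lambda>i. x i + z i) = (\<lambda>i. T x i + T z i)"
    using assms(1,2) z unfolding linear_between_def topspace_kothe_topology by blast
  moreover have "T z = (\<lambda>i. (-1) * T y i)"
    using assms(1,3) unfolding z_def linear_between_def topspace_kothe_topology by blast
  ultimately show ?thesis by (simp add: z_def)
qed

text \<open>A seminorm bound controls \<open>T\<close> near zero; applied to \<open>y - x\<close>,
  it gives continuity at every \<open>x\<close> by linearity.\<close>

lemma continuous_map_kothe_linear:
  fixes T :: "(nat \<Rightarrow> 'a::{real_normed_field,banach}) \<Rightarrow> (nat \<Rightarrow> 'a)"
  assumes a: "kothe_matrix a" and b: "kothe_matrix b"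
    and T: "linear_between (kothe_topology a) (kothe_topology b) T"
    and bd: "\<And>k. \<exists>l c. \<forall>x\<in>kothe_space a. kothe_seminorm b k (T x) \<le> c * kothe_seminorm a l x"
  shows "continuous_map (kothe_topology a) (kothe_topology b) T"
proof (rule continuous_map_eq_topcontinuous_at[THEN iffD2], intro ballI)
  fix x :: "nat \<Rightarrow> 'a" assume "x \<in> topspace (kothe_topology a)"
  then have x: "x \<in> kothe_space a" by simp
  have Tin: "T z \<in> kothe_space b" if "z \<in> kothe_space a" for z
    using T that by (auto simp: linear_between_def)
  show "topcontinuous_at (kothe_topology a) (kothe_topology b) T x"
    unfolding topcontinuous_at_def
  proof (intro conjI allI impI)
    fix V assume "openin (kothe_topology b) V \<and> T x \<in> V"
    then obtain k \<epsilon> where ke: "0 < \<epsilon>" "kothe_ball b k (T x) \<epsilon> \<subseteq> V"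
      using openin_kothe_topologyD[OF b] by metis
    obtain l c where c: "\<And>x. x \<in> kothe_space a \<Longrightarrow> kothe_seminorm b k (T x) \<le> c * kothe_seminorm a l x"
      using bd by meson
    \<comment> \<open>The constant \<open>c\<close> may be zero or negative;
      \<open>\<bar>c\<bar> + 1\<close> is a positive replacement by which one can divide.\<close>
    define \<delta> where "\<delta> = \<epsilon> / (\<bar>c\<bar> + 1)"
    have \<delta>: "0 < \<delta>" using ke by (simp add: \<delta>_def)
    have "T y \<in> V" if y: "y \<in> kothe_ball a l x \<delta>" for y
    proof -
      have ys: "y \<in> kothe_space a" using y by (simp add: kothe_ball_def)
      note d = kothe_space_diff[OF a ys x]
      note nn = kothe_seminorm_nonneg[OF a d, of l]
      have "kothe_seminorm b k (\<lambda>i. T y i - T x i) \<le> c * kothe_seminorm a l (\<lambda>i. y i - x i)"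
        using c[OF d] linear_between_kothe_diff[OF T ys x] by simp
      also have "\<dots> \<le> (\<bar>c\<bar> + 1) * kothe_seminorm a l (\<lambda>i. y i - x i)"
        by (intro mult_right_mono nn) simp
      also have "\<dots> < (\<bar>c\<bar> + 1) * \<delta>"
        using y by (intro mult_strict_left_mono) (simp_all add: kothe_ball_def)
      also have "\<dots> = \<epsilon>" by (simp add: \<delta>_def)
      finally show ?thesis
        using ke Tin[OF ys] by (auto simp: kothe_ball_def)
    qed
    then show "\<exists>U. openin (kothe_topology a) U \<and> x \<in> U \<and> (\<forall>y\<in>U. T y \<in> V)"
      using openin_kothe_ball[OF x \<delta>] centre_in_kothe_ball[OF x \<delta>] by blast
  qed (use x Tin in auto)
qed

section \<open>Bounded and precompact sets\<close>

lemma bounded_in_kotheI: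
  fixes S :: "(nat \<Rightarrow> 'a::{real_normed_field,banach}) set"
  assumes b: "kothe_matrix b" and S: "S \<subseteq> kothe_space b"
    and bd: "\<And>k. \<exists>c. \<forall>x\<in>S. kothe_seminorm b k x \<le> c"
  shows "bounded_in (kothe_topology b) S"
  unfolding bounded_in_def
proof (intro conjI allI impI)
  fix U :: "(nat \<Rightarrow> 'a) set" assume "zero_nbhd (kothe_topology b) U"
  then obtain k \<epsilon> where ke: "0 < \<epsilon>" "kothe_ball b k (\<lambda>_. 0) \<epsilon> \<subseteq> U"
    using zero_nbhd_kotheD[OF b] by metis
  obtain c where c: "\<And>x. x \<in> S \<Longrightarrow> kothe_seminorm b k x \<le> c"
    using bd by meson
  \<comment> \<open>Dividing by this \<open>t\<close> brings every seminorm value up to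
    \<open>c\<close> strictly below \<epsilon>; the summand 1 gives both strictness and
    \<open>0 < t\<close>.\<close>
  define t where "t = (\<bar>c\<bar> + 1) / \<epsilon>"
  have t: "0 < t" using ke by (simp add: t_def add_nonneg_pos)
  have "x \<in> (\<lambda>x i. of_real t * x i) ` U" if x: "x \<in> S" for x
  proof
    let ?z = "\<lambda>i. inverse (of_real t :: 'a) * x i"
    show "x = (\<lambda>i. of_real t * ?z i)" using t by (simp add: mult.assoc[symmetric])
    have "kothe_seminorm b k ?z = kothe_seminorm b k x / t"
      using kothe_space_scale(2)[of x b k "inverse (of_real t)"] S x t
      by (auto simp: norm_inverse divide_inverse mult.commute)
    also have "\<dots> < \<epsilon>"
    proof -
      have "kothe_seminorm b k x < t * \<epsilon>"
        using c[OF x] ke by (simp add: t_def)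
      then show ?thesis
        using t by (simp add: pos_divide_less_eq mult.commute)
    qed
    finally show "?z \<in> U"
      using ke kothe_space_scale(1)[of x b] S x by (auto simp: kothe_ball_def)
  qed
  then show "\<exists>t>0. S \<subseteq> (\<lambda>x i. of_real t * x i) ` U" using t by blast
qed (use S in simp)

text \<open>The \<epsilon>-balls around the points of the compact closure cover it, and the centres
  of a finite subcover form the required finite set. These centres lie in the closure rather than in
  \<open>S\<close>, which \<open>precompact_in\<close> permits.\<close>

lemma relatively_compact_in_kothe_imp_precompact_in:
  fixes S :: "(nat \<Rightarrow> 'a::{real_normed_field,banach}) set"
  assumes b: "kothe_matrix b" and "relatively_compact_in (kothe_topology b) S"
  shows "precompact_in (kothe_topology b) S"
  unfolding precompact_in_def
proof (intro conjI allI impI)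
  let ?Y = "kothe_topology b"
  show S: "S \<subseteq> topspace ?Y"
    using assms(2) by (simp add: relatively_compact_in_def)
  fix U :: "(nat \<Rightarrow> 'a) set" assume "zero_nbhd ?Y U"
  then obtain k \<epsilon> where ke: "0 < \<epsilon>" "kothe_ball b k (\<lambda>_. 0) \<epsilon> \<subseteq> U"
    using zero_nbhd_kotheD[OF b] by metis
  let ?B = "\<lambda>x. kothe_ball b k x \<epsilon>"
  let ?K = "?Y closure_of S"
  have K: "compactin ?Y ?K" "?K \<subseteq> kothe_space b"
    using assms(2) closure_of_subset_topspace[of ?Y S] by (simp_all add: relatively_compact_in_def)
  have "\<exists>\<F>. finite \<F> \<and> \<F> \<subseteq> ?B ` ?K \<and> ?K \<subseteq> \<Union>\<F>"
  proof (rule compactinD[OF K(1)])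
    show "openin ?Y V" if "V \<in> ?B ` ?K" for V
      using that K(2) openin_kothe_ball[OF _ ke(1)] by blast
    show "?K \<subseteq> \<Union> (?B ` ?K)"
      using K(2) centre_in_kothe_ball[OF _ ke(1)] by blast
  qed
  then obtain A where A: "finite A" "A \<subseteq> ?K" "?K \<subseteq> (\<Union>a\<in>A. ?B a)"
    by (metis finite_subset_image)
  \<comment> \<open>The seminorm is translation invariant: a ball around \<open>a\<close> is
    \<open>a\<close> plus elements of the ball around zero, which lies in \<open>U\<close>.\<close>
  have "?B a \<subseteq> (\<lambda>x i. a i + x i) ` U" if "a \<in> A" for a
  proof
    fix y assume y: "y \<in> ?B a"
    have "a \<in> kothe_space b" using that A K by blast
    then have "(\<lambda>i. y i - a i) \<in> U"
      using ke y kothe_space_diff[OF b, of y a] by (auto simp: kothe_ball_def)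
    then show "y \<in> (\<lambda>x i. a i + x i) ` U"
      by (auto intro!: image_eqI[of _ _ "\<lambda>i. y i - a i"])
  qed
  then have "(\<Union>a\<in>A. ?B a) \<subseteq> (\<Union>a\<in>A. (\<lambda>x i. a i + x i) ` U)"
    by (intro UN_mono) simp_all
  then have "S \<subseteq> (\<Union>a\<in>A. (\<lambda>x i. a i + x i) ` U)"
    by (rule order_trans[OF order_trans[OF closure_of_subset[OF S] A(3)]])
  then show "\<exists>A. finite A \<and> A \<subseteq> topspace ?Y \<and> S \<subseteq> (\<Union>a\<in>A. (\<lambda>x i. a i + x i) ` U)"
    using A(1) order_trans[OF A(2) K(2)] by (intro exI[of _ A]) simp
qed

section \<open>Hankel operators\<close>

lemma kothe_matrix_power_series:
  assumes "\<And>n. 0 \<le> \<alpha> n"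
  shows "kothe_matrix (power_series_matrix \<alpha>)"
  using assms by (auto simp: kothe_matrix_def power_series_matrix_def mult_right_mono)

text \<open>The sum of two indices is at most twice the larger one, so stability bounds \<alpha>
  there by its value at the larger index. Adding the other non-negative value makes the bound
  symmetric.\<close>

lemma stable_sequence_add_le:
  assumes "stable_sequence \<alpha>" "mono \<alpha>" "\<And>n. 0 \<le> \<alpha> n"
  obtains M where "0 \<le> M" "\<And>i j. \<alpha> (i + j) \<le> M * (\<alpha> i + \<alpha> j)"
proof -
  obtain M where M: "\<And>n. n \<ge> 1 \<Longrightarrow> \<alpha> (2 * n - 1) \<le> M * \<alpha> (n - 1)"
    using assms(1) by (auto simp: stable_sequence_def)
  have le: "\<alpha> (i + j) \<le> \<bar>M\<bar> * \<alpha> i" if "j \<le> i" for i j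
  proof -
    \<comment> \<open>Position \<open>i\<close> encodes the 1-based index \<open>i + 1\<close>,
      whose double sits at position \<open>2 * Suc i - 1 = 2 * i + 1\<close>; this is beyond
      \<open>i + j\<close> when \<open>j \<le> i\<close>.\<close>
    have "\<alpha> (i + j) \<le> \<alpha> (2 * Suc i - 1)"
      using that by (intro monoD[OF assms(2)]) simp
    also have "\<dots> \<le> M * \<alpha> i" using M[of "Suc i"] by simp
    also have "\<dots> \<le> \<bar>M\<bar> * \<alpha> i" by (intro mult_right_mono assms) simp
    finally show ?thesis .
  qed
  show thesis
  proof (rule that[of "\<bar>M\<bar>"])
    fix i j
    have "0 \<le> \<bar>M\<bar> * \<alpha> i" "0 \<le> \<bar>M\<bar> * \<alpha> j" using assms(3) by simp_all
    then show "\<alpha> (i + j) \<le> \<bar>M\<bar> * (\<alpha> i + \<alpha> j)"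
      using le[of j i] le[of i j] by (cases "j \<le> i") (simp_all add: distrib_left add.commute)
  qed simp
qed

text \<open>The exponential turns the additive bound on \<alpha> at \<open>j + n\<close> into a
  product, which separates the row index from the column index of the Hankel matrix.\<close>

lemma power_series_dual_product_bound:
  fixes \<theta> :: "nat \<Rightarrow> 'a::{real_normed_field,banach}"
  assumes "stable_sequence \<alpha>" "mono \<alpha>" and \<alpha>: "\<And>n. 0 \<le> \<alpha> n" and "\<theta> \<in> power_series_dual \<alpha>"
  obtains C r where "\<And>j n. norm (\<theta> (j + n)) \<le> C * power_series_matrix \<alpha> j r * power_series_matrix \<alpha> n r"
proof -
  obtain p C where "\<And>n. norm (\<theta> n) * exp (- real p * \<alpha> n) \<le> C"
    using assms(4) by (auto simp: power_series_dual_def bdd_above_def)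
  then have C: "norm (\<theta> n) \<le> C * exp (real p * \<alpha> n)" for n
    by (simp add: exp_minus field_simps)
  \<comment> \<open>The sign of \<open>C\<close> is read off from the bound at index 0; it is needed
    to multiply the exponential estimate by \<open>C\<close>.\<close>
  have "0 \<le> C" using order_trans[OF norm_ge_zero C[of 0]] by (simp add: zero_le_mult_iff)
  obtain M where M: "0 \<le> M" "\<And>i j. \<alpha> (i + j) \<le> M * (\<alpha> i + \<alpha> j)"
    using stable_sequence_add_le[OF assms(1-3)] by metis
  obtain r where r: "real p * M \<le> real r" using real_arch_simple by blast
  show thesis
  proof (rule that)
    fix j n
    have "real p * \<alpha> (j + n) \<le> real p * (M * (\<alpha> j + \<alpha> n))"
      by (intro mult_left_mono M) simp
    also have "\<dots> = (real p * M) * (\<alpha> j + \<alpha> n)" by simp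
    \<comment> \<open>Column \<open>r\<close> of the power series matrix carries the exponent
      \<open>r + 1\<close>, so the choice of \<open>r\<close> leaves room to spare.\<close>
    also have "\<dots> \<le> real (Suc r) * (\<alpha> j + \<alpha> n)"
      using r \<alpha> by (intro mult_right_mono) auto
    finally have "exp (real p * \<alpha> (j + n)) \<le> power_series_matrix \<alpha> j r * power_series_matrix \<alpha> n r"
      by (simp add: power_series_matrix_def distrib_left flip: exp_add)
    then show "norm (\<theta> (j + n)) \<le> C * power_series_matrix \<alpha> j r * power_series_matrix \<alpha> n r"
      using order_trans[OF C mult_left_mono[OF _ \<open>0 \<le> C\<close>]] by (simp add: mult.assoc)
  qed
qed

text \<open>The coordinatewise limit of the series, which is available before convergence in the codomain.\<close>

definition hankel_image :: "(nat \<Rightarrow> 'a::{real_normed_field,banach}) \<Rightarrow> (nat \<Rightarrow> 'a) \<Rightarrow> nat \<Rightarrow> 'a" where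
  "hankel_image \<theta> x = (\<lambda>j. \<Sum>n. x n * \<theta> (j + n))"

section \<open>Hankel operators with a product majorant\<close>

text \<open>Isolates what the operator theory uses: the matrix entries are dominated by a product
  whose row factor \<open>w\<close> is summable against every column of \<open>b\<close> and whose
  column factor is the weight of one seminorm of the domain.\<close>

locale hankel_product_bound =
  fixes a b :: "nat \<Rightarrow> nat \<Rightarrow> real" and \<theta> :: "nat \<Rightarrow> 'a::{real_normed_field,banach}"
    and w :: "nat \<Rightarrow> real" and C :: real and r :: nat
  assumes a: "kothe_matrix a" and b: "kothe_matrix b"
    and bound: "\<And>j n. norm (\<theta> (j + n)) \<le> C * w j * a n r"
    and w: "\<And>k. summable (\<lambda>j. w j * b j k)"
begin

lemma term_bound: "norm (x n * \<theta> (j + n)) \<le> C * w j * (norm (x n) * a n r)"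
  using mult_left_mono[OF bound norm_ge_zero, of "x n" j n] by (simp add: norm_mult mult_ac)

lemma summable_term:
  assumes "x \<in> kothe_space a"
  shows "summable (\<lambda>n. norm (x n * \<theta> (j + n)))"
proof (rule summable_comparison_test')
  show "summable (\<lambda>n. C * w j * (norm (x n) * a n r))"
    using assms by (intro summable_mult) (simp add: kothe_space_def)
qed (use term_bound in simp)

text \<open>The central estimate: the coordinate \<open>j\<close> enters only through
  \<open>w j\<close>, while the other factor is a tail of the \<open>r\<close>-th seminorm of
  \<open>x\<close>. Taking \<open>N = 0\<close> bounds the operator; letting \<open>N\<close> grow
  gives convergence of the series.\<close>

lemma tail_bound:
  assumes "x \<in> kothe_space a"
  shows "norm (hankel_image \<theta> x j - hankel_partial_sum \<theta> x N j)
    \<le> (C * (\<Sum>n. norm (x (n + N)) * a (n + N) r)) * w j"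
proof -
  let ?f = "\<lambda>n. x n * \<theta> (j + n)"
  have sx: "summable (\<lambda>n. norm (x n) * a n r)"
    using assms by (simp add: kothe_space_def)
  have s: "summable (\<lambda>n. norm (?f (n + N)))"
    using summable_term[OF assms] by (rule summable_ignore_initial_segment)
  have "hankel_image \<theta> x j - hankel_partial_sum \<theta> x N j = (\<Sum>n. ?f (n + N))"
    using suminf_minus_initial_segment[OF summable_norm_cancel[OF summable_term[OF assms]], of N j]
    by (simp add: hankel_image_def hankel_partial_sum_def hankel_column_def)
  also have "norm \<dots> \<le> (\<Sum>n. norm (?f (n + N)))"
    by (rule summable_norm[OF s])
  also have "\<dots> \<le> (\<Sum>n. C * w j * (norm (x (n + N)) * a (n + N) r))"
    by (intro suminf_le s summable_mult summable_ignore_initial_segment sx term_bound)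
  also have "\<dots> = C * w j * (\<Sum>n. norm (x (n + N)) * a (n + N) r)"
    by (intro suminf_mult summable_ignore_initial_segment sx)
  finally show ?thesis by (simp add: mult_ac)
qed

lemma hankel_image_bound:
  assumes "x \<in> kothe_space a"
  shows "hankel_image \<theta> x \<in> kothe_space b"
    and "kothe_seminorm b k (hankel_image \<theta> x) \<le> C * kothe_seminorm a r x * (\<Sum>j. w j * b j k)"
proof -
  \<comment> \<open>For \<open>N = 0\<close> the partial sum is empty and the tail is the whole
    seminorm.\<close>
  have le: "norm (hankel_image \<theta> x j) \<le> (C * kothe_seminorm a r x) * w j" for j
    using tail_bound[OF assms, of j 0] by (simp add: hankel_partial_sum_def kothe_seminorm_def)
  show "hankel_image \<theta> x \<in> kothe_space b"
    and "kothe_seminorm b k (hankel_image \<theta> x) \<le> C * kothe_seminorm a r x * (\<Sum>j. w j * b j k)"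
    using kothe_space_dominated[OF w le b] by auto
qed

lemma hankel_column_in_kothe_space: "hankel_column \<theta> n \<in> kothe_space b"
  by (rule kothe_space_dominated(1)[OF w _ b, where c = "C * a n r"])
    (use bound in \<open>simp add: hankel_column_def mult_ac\<close>)

lemma hankel_partial_sum_in_kothe_space: "hankel_partial_sum \<theta> x N \<in> kothe_space b"
proof (induction N)
  case 0
  then show ?case by (simp add: hankel_partial_sum_def kothe_space_zero)
next
  case (Suc N)
  then show ?case
    using kothe_space_add(1)[OF b Suc kothe_space_scale(1)[OF hankel_column_in_kothe_space]]
    by (simp add: hankel_partial_sum_def)
qed

text \<open>In each seminorm the error is at most a constant times the tail of a convergent
  series.\<close>

lemma limitin_hankel_partial_sum:
  assumes x: "x \<in> kothe_space a"
  shows "limitin (kothe_topology b) (hankel_partial_sum \<theta> x) (hankel_image \<theta> x) sequentially"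
proof (rule limitin_kotheI[OF b hankel_image_bound(1)[OF x] hankel_partial_sum_in_kothe_space])
  fix k
  let ?T = "\<lambda>N. \<Sum>n. norm (x (n + N)) * a (n + N) r"
  let ?d = "\<lambda>N i. hankel_partial_sum \<theta> x N i - hankel_image \<theta> x i"
  have "?T \<longlonglongrightarrow> 0"
    using x by (intro suminf_exist_split2) (simp add: kothe_space_def)
  then have lim: "(\<lambda>N. (C * ?T N) * (\<Sum>j. w j * b j k)) \<longlonglongrightarrow> 0"
    by (intro tendsto_mult_left_zero tendsto_mult_right_zero)
  show "(\<lambda>N. kothe_seminorm b k (?d N)) \<longlonglongrightarrow> 0"
  proof (rule tendsto_sandwich[OF _ _ tendsto_const lim])
    show "\<forall>\<^sub>F N in sequentially. 0 \<le> kothe_seminorm b k (?d N)"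
      by (intro always_eventually allI kothe_seminorm_nonneg b kothe_space_diff
          hankel_partial_sum_in_kothe_space hankel_image_bound(1) x)
    show "\<forall>\<^sub>F N in sequentially. kothe_seminorm b k (?d N) \<le> (C * ?T N) * (\<Sum>j. w j * b j k)"
      using tail_bound[OF x]
      by (intro always_eventually allI kothe_space_dominated(2) w b) (simp add: norm_minus_commute)
  qed
qed

lemma hankel_well_defined: "hankel_well_defined (kothe_topology a) (kothe_topology b) \<theta>"
  using hankel_column_in_kothe_space limitin_hankel_partial_sum
  by (auto simp: hankel_well_defined_def)

text \<open>Replaces the topological limit by the explicit coordinatewise series, so that linearity
  and bounds can be checked on the latter.\<close>

lemma hankel_operator_eq:
  assumes "x \<in> kothe_space a"
  shows "hankel_operator (kothe_topology b) \<theta> x = hankel_image \<theta> x"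
  unfolding hankel_operator_def
proof (rule the_equality)
  show "limitin (kothe_topology b) (hankel_partial_sum \<theta> x) (hankel_image \<theta> x) sequentially"
    by (rule limitin_hankel_partial_sum[OF assms])
  show "y = hankel_image \<theta> x"
    if "limitin (kothe_topology b) (hankel_partial_sum \<theta> x) y sequentially" for y
    by (rule limitin_Hausdorff_unique[OF that limitin_hankel_partial_sum[OF assms]
          trivial_limit_sequentially Hausdorff_kothe_topology[OF b]])
qed

lemma linear_between_hankel_operator:
  "linear_between (kothe_topology a) (kothe_topology b) (hankel_operator (kothe_topology b) \<theta>)"
proof -
  \<comment> \<open>Convergence of every coordinate series is what allows sums and scalars to be
    moved through \<open>suminf\<close>.\<close>
  have s: "summable (\<lambda>n. x n * \<theta> (j + n))" if "x \<in> kothe_space a" for x j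
    by (rule summable_norm_cancel[OF summable_term[OF that]])
  have "hankel_image \<theta> (\<lambda>i. x i + y i) = (\<lambda>j. hankel_image \<theta> x j + hankel_image \<theta> y j)"
    if "x \<in> kothe_space a" "y \<in> kothe_space a" for x y
    using suminf_add[OF s[OF that(1)] s[OF that(2)]] by (simp add: hankel_image_def distrib_right)
  moreover have "hankel_image \<theta> (\<lambda>i. c * x i) = (\<lambda>j. c * hankel_image \<theta> x j)"
    if "x \<in> kothe_space a" for c x
    using suminf_mult[OF s[OF that]] by (simp add: hankel_image_def mult.assoc)
  ultimately show ?thesis
    by (simp add: linear_between_def hankel_operator_eq hankel_image_bound(1)
        kothe_space_add(1)[OF a] kothe_space_scale(1))
qed

lemma continuous_map_hankel_operator:
  "continuous_map (kothe_topology a) (kothe_topology b) (hankel_operator (kothe_topology b) \<theta>)"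
proof (rule continuous_map_kothe_linear[OF a b linear_between_hankel_operator])
  fix k
  show "\<exists>l c. \<forall>x\<in>kothe_space a.
      kothe_seminorm b k (hankel_operator (kothe_topology b) \<theta> x) \<le> c * kothe_seminorm a l x"
    using hankel_image_bound(2)[of _ k]
    by (intro exI[of _ r] exI[of _ "C * (\<Sum>j. w j * b j k)"]) (simp add: hankel_operator_eq mult_ac)
qed

lemma compact_operator_hankel_operator:
  assumes "montel (kothe_topology b :: (nat \<Rightarrow> 'a) topology)"
  shows "compact_operator (kothe_topology a) (kothe_topology b) (hankel_operator (kothe_topology b) \<theta>)"
proof -
  let ?H = "hankel_operator (kothe_topology b) \<theta>"
  \<comment> \<open>The index \<open>r\<close> of this ball serves all target seminorms
    simultaneously, so its image is bounded as a set.\<close>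
  let ?U = "kothe_ball a r (\<lambda>_. 0) 1"
  have "bounded_in (kothe_topology b) (?H ` ?U)"
  proof (rule bounded_in_kotheI[OF b])
    show "?H ` ?U \<subseteq> kothe_space b"
      by (auto simp: kothe_ball_def hankel_operator_eq hankel_image_bound(1))
  next
    fix k
    let ?D = "\<Sum>j. w j * b j k"
    \<comment> \<open>The absolute value is taken because the locale does not fix the signs of
      \<open>C\<close> and \<open>w\<close>.\<close>
    have "kothe_seminorm b k (?H x) \<le> \<bar>C * ?D\<bar>" if "x \<in> ?U" for x
    proof -
      have x: "x \<in> kothe_space a" "kothe_seminorm a r x \<le> 1"
        using that by (simp_all add: kothe_ball_def)
      have "kothe_seminorm b k (?H x) \<le> (C * ?D) * kothe_seminorm a r x"
        using hankel_image_bound(2)[OF x(1), of k] by (simp add: hankel_operator_eq x mult_ac)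
      also have "\<dots> \<le> \<bar>C * ?D\<bar> * kothe_seminorm a r x"
        by (intro mult_right_mono kothe_seminorm_nonneg a x) simp
      also have "\<dots> \<le> \<bar>C * ?D\<bar>"
        using mult_left_mono[OF x(2), of "\<bar>C * ?D\<bar>"] by simp
      finally show ?thesis .
    qed
    then show "\<exists>c. \<forall>y\<in>?H ` ?U. kothe_seminorm b k y \<le> c" by blast
  qed
  then have "precompact_in (kothe_topology b) (?H ` ?U)"
    using assms relatively_compact_in_kothe_imp_precompact_in[OF b] by (auto simp: montel_def)
  then show ?thesis
    using linear_between_hankel_operator zero_nbhd_kothe_ball[of 1 a r]
    unfolding compact_operator_def by auto
qed

end

theorem proposition3p12:
  fixes \<alpha> :: "nat \<Rightarrow> real" and b :: "nat \<Rightarrow> nat \<Rightarrow> real"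
    and \<theta> :: "nat \<Rightarrow> 'a::{real_normed_field,banach}"
  assumes "\<forall>n. 0 \<le> \<alpha> n" and "mono \<alpha>" and "filterlim \<alpha> at_top sequentially"
    and "stable_sequence \<alpha>"
    and "kothe_matrix b"
    and "\<theta> \<in> power_series_dual \<alpha>"
    and "\<forall>m::nat. m \<ge> 1 \<longrightarrow> (\<lambda>n. of_real (exp (real m * \<alpha> n)) :: 'a) \<in> kothe_space b"
  shows "hankel_well_defined (power_series_topology \<alpha>) (kothe_topology b) \<theta> \<and>
         continuous_map (power_series_topology \<alpha>) (kothe_topology b)
           (hankel_operator (kothe_topology b) \<theta>) \<and>
         (montel (kothe_topology b :: (nat \<Rightarrow> 'a) topology) \<longrightarrow>
           compact_operator (power_series_topology \<alpha>) (kothe_topology b)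
             (hankel_operator (kothe_topology b) \<theta>))"
proof -
  have \<alpha>: "\<And>n. 0 \<le> \<alpha> n" using assms(1) by blast
  obtain C r where C: "\<And>j n. norm (\<theta> (j + n))
      \<le> C * power_series_matrix \<alpha> j r * power_series_matrix \<alpha> n r"
    using power_series_dual_product_bound[OF assms(4,2) \<alpha> assms(6)] by metis
  \<comment> \<open>The hypothesis is used with \<open>m = Suc r\<close>, the exponent encoded by
    column \<open>r\<close>; this column then serves as the row weight \<open>w\<close>.\<close>
  have "(\<lambda>n. of_real (exp (real (Suc r) * \<alpha> n)) :: 'a) \<in> kothe_space b"
    using assms(7)[rule_format, of "Suc r"] by simp
  then have "\<And>k. summable (\<lambda>j. power_series_matrix \<alpha> j r * b j k)"
    by (simp add: kothe_space_def power_series_matrix_def)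
  then interpret hankel_product_bound "power_series_matrix \<alpha>" b \<theta> "\<lambda>j. power_series_matrix \<alpha> j r" C r
    using kothe_matrix_power_series[OF \<alpha>] assms(5) C by unfold_locales
  show ?thesis
    using hankel_well_defined continuous_map_hankel_operator compact_operator_hankel_operator by blast
qed

end
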